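(* Let $b\in C^1(\mathbb R)$ have bounded derivative and assume that there exists $\mathfrak m_b>0$ such that $b'(x)\leqslant-\mathfrak m_b$ for every $x\in\mathbb R$. Let $X$ be the stationary solution of $X_t=X_0+\int_0^t b(X_s)\,ds+\sigma B_t$, $t\in\mathbb R_+$, let $f$ be the density of $X_0$, and assume that $f\in\mathbb L^2(\mathbb R,dr)$. Assume moreover that: (i) for every $m\in\mathbb N^*$, the elements $\varphi_1,\dots,\varphi_m$ of $\mathcal B_m$ are bounded and Lipschitz continuous functions; (ii) the spaces $\mathcal S_m$ are nested: for every $m,m'\in\mathcal M$, if $m\geqslant m'$, then $\mathcal S_{m'}\subset\mathcal S_m$; (iii) the map $m\mapsto L(m)$ has polynomial growth. If $\mathfrak K\geqslant 16\mathfrak c$, where $\mathfrak c$ is the constant of the concentration inequality recalled in the context, then there exist two positive constants $\mathfrak c_1$ and $\mathfrak c_2$, not depending on $n$, such that $$\mathbb E(\|\widehat f_{\widehat m}-f\|^2)\leqslant\mathfrak c_1\min_{m\in\mathcal M}\{\|f_m-f\|^2+\mathrm{pen}(m)\}+\frac{\mathfrak c_2}{(n\Delta_n)^{\mathfrak b_H}}.$$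
   Context: Equation and sampling. $B=(B_t)_{t\in\mathbb R_+}$ is a fractional Brownian motion of Hurst index $H\in(0,1)$ and $\sigma\in\mathbb R\setminus\{0\}$. Under the stated conditions on $b$ ($b\in C^1(\mathbb R)$, $b'$ bounded, $b'\leqslant-\mathfrak m_b<0$), it is known that the equation $X_t=X_0+\int_0^tb(X_s)ds+\sigma B_t$ has a unique stationary solution $X=(X_t)_{t\in\mathbb R_+}$ (in particular $X_t$ has the same distribution as $X_0$ for every $t$), and that $X_0$ has a density $f$ with respect to Lebesgue's measure. The process is observed at times $t_i:=i\Delta_n$, $i\in\{1,\dots,n\}$, where $\Delta_n>0$, $\lim_{n\to\infty}\Delta_n=0$ and $\lim_{n\to\infty}n\Delta_n=\infty$. Put $\mathfrak a_H:=(2H)\vee1$ and $\mathfrak b_H:=1\wedge(2-2H)$. Known concentration inequality (defining the constant $\mathfrak c$). $\mathbb R^n$ is equipped with the distance $d_1(\mathbf x,\mathbf y)=\sum_{i=1}^n|\mathbf y_i-\mathbf x_i|$, and $\|\cdot\|_{\rm Lip}$ denotes the Lipschitz semi-norm (best Lipschitz constant). Under the stated conditions on $b$ it is known (Bertin, Klutchnikoff, Panloup and Varvenne) that there exists a constant $\mathfrak c>0$, not depending on $n$, such that for every Lipschitz map $F:(\mathbb R^n,d_1)\to\mathbb R$ and every $r>0$, $$\mathbb P(F(X_{t_1},\dots,X_{t_n})-\mathbb E(F(X_{t_1},\dots,X_{t_n}))>r)\leqslant\exp\left(-\frac{r^2}{\mathfrak c\|F\|_{\rm Lip}^2n^{\mathfrak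 a_H}\Delta_n^{-\mathfrak b_H}}\right)$$ (the right-hand side being read as $0$ if $\|F\|_{\rm Lip}=0$). Such a constant $\mathfrak c$ is fixed. Projection spaces. $I\subset\mathbb R$ is an interval; $\langle\cdot,\cdot\rangle$ and $\|\cdot\|$ are the usual scalar product and norm of $\mathbb L^2(I,dr)$. Functions on $I$ are identified with functions on $\mathbb R$ supported in $I$, and Lipschitz semi-norms are those of the corresponding functions on $\mathbb R$. For every $m\in\mathbb N^*=\mathbb N\setminus\{0\}$, $\mathcal B_m=\{\varphi_1,\dots,\varphi_m\}$ is an orthonormal family of $\mathbb L^2(I,dr)$ (possibly depending on $m$, although this is not displayed in the notation), and $\mathcal S_m$ is the vector space generated by $\mathcal B_m$. $f_m$ is the orthogonal projection of $f$ on $\mathcal S_m$ in $\mathbb L^2(I,dr)$, and $$L(m):=\sum_{j=1}^m\|\varphi_j\|_{\rm Lip}^2.$$ "Polynomial growth" means that $L(m)$ is bounded by a constant times a power of $m$, for all $m\in\mathbb N^*$. Estimators. $$\widehat f_m:=\sum_{j=1}^m\left(\frac1n\sum_{i=1}^n\varphi_j(X_{t_i})\right)\varphi_j,\qquad\widehat\gamma_n(\varphi):=\|\varphi\|^2-\frac2n\sum_{i=1}^n\varphi(X_{t_i}).$$ The collection of models is $\mathcal M:=\{m\in\mathbb N^*:mL(m)\leqslant(n\Delta_n)^{\mathfrak b_H}\}$ (it depends on $n$; $n$ is taken such that $\mathcal M\neq\emptyset$, so that the following is meaningful). For a hyper-parameter $\mathfrak K>0$, $$\mathrm{pen}(m):=\mathfrak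 K\frac{(m+1)L(m)}{(n\Delta_n)^{\mathfrak b_H}},\quad m\in\mathcal M,\qquad\widehat m=\arg\min_{m\in\mathcal M}\{\widehat\gamma_n(\widehat f_m)+\mathrm{pen}(m)\},$$ and the adaptive estimator is $\widehat f_{\widehat m}$. *)

theory Defs
  imports "HOL-Probability.Probability"
begin

text \<open>Processes indexed by the half line are
  functions of type \<^typ>\<open>real \<Rightarrow> 'a \<Rightarrow> real\<close> of which only the times \<open>t \<ge> 0\<close> matter.\<close>

text \<open>Point masses count as (degenerate) Gaussian laws; \<^const>\<open>normal_density\<close> requires a positive
  standard deviation to be a probability density.\<close>

definition gaussian_rv :: "'a measure \<Rightarrow> ('a \<Rightarrow> real) \<Rightarrow> bool" where
  "gaussian_rv M Y \<longleftrightarrow> Y \<in> borel_measurable M \<and>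
     ((\<exists>\<mu> s. 0 < s \<and> distributed M lborel Y (\<lambda>x. ennreal (normal_density \<mu> s x))) \<or>
      (\<exists>\<mu>. AE \<omega> in M. Y \<omega> = \<mu>))"

definition fractional_brownian_motion :: "'a measure \<Rightarrow> real \<Rightarrow> (real \<Rightarrow> 'a \<Rightarrow> real) \<Rightarrow> bool" where
  "fractional_brownian_motion M H B \<longleftrightarrow>
     (\<forall>t\<ge>0. B t \<in> borel_measurable M) \<and>
     (\<forall>J a. finite J \<and> J \<subseteq> {0..} \<longrightarrow> gaussian_rv M (\<lambda>\<omega>. \<Sum>t\<in>J. a t * B t \<omega>)) \<and>
     (\<forall>t\<ge>0. (\<integral>\<omega>. B t \<omega> \<partial>M) = 0) \<and>
     (\<forall>s\<ge>0. \<forall>t\<ge>0. (\<integral>\<omega>. B s \<omega> * B t \<omega> \<partial>M) =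
        (s powr (2 * H) + t powr (2 * H) - \<bar>t - s\<bar> powr (2 * H)) / 2) \<and>
     (AE \<omega> in M. continuous_on {0..} (\<lambda>t. B t \<omega>))"

definition solves_equation ::
  "'a measure \<Rightarrow> (real \<Rightarrow> real) \<Rightarrow> real \<Rightarrow> (real \<Rightarrow> 'a \<Rightarrow> real) \<Rightarrow> (real \<Rightarrow> 'a \<Rightarrow> real) \<Rightarrow> bool" where
  "solves_equation M b \<sigma> B X \<longleftrightarrow>
     (\<forall>t\<ge>0. X t \<in> borel_measurable M) \<and>
     (AE \<omega> in M. \<forall>t\<ge>0.
        set_integrable lborel {0..t} (\<lambda>s. b (X s \<omega>)) \<and>
        X t \<omega> = X 0 \<omega> + (LINT s:{0..t}|lborel. b (X s \<omega>)) + \<sigma> * B t \<omega>)"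

definition stationary_process :: "'a measure \<Rightarrow> (real \<Rightarrow> 'a \<Rightarrow> real) \<Rightarrow> bool" where
  "stationary_process M X \<longleftrightarrow>
     (\<forall>J h. finite J \<and> J \<subseteq> {0..} \<and> 0 \<le> h \<longrightarrow>
        distr M (\<Pi>\<^sub>M t\<in>J. borel) (\<lambda>\<omega>. \<lambda>t\<in>J. X (t + h) \<omega>) =
        distr M (\<Pi>\<^sub>M t\<in>J. borel) (\<lambda>\<omega>. \<lambda>t\<in>J. X t \<omega>))"

definition hurst_a :: "real \<Rightarrow> real" where
  "hurst_a H = max (2 * H) 1"

definition hurst_b :: "real \<Rightarrow> real" where
  "hurst_b H = min 1 (2 - 2 * H)"

text \<open>Lipschitz maps with respect to a (pseudo-)distance \<open>d\<close>, and their best Lipschitz constant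
  (for \<^term>\<open>d = dist\<close> these are the notions of \<^const>\<open>lipschitz_on\<close>, see below).\<close>

definition lipschitz_wrt :: "('v \<Rightarrow> 'v \<Rightarrow> real) \<Rightarrow> ('v \<Rightarrow> real) \<Rightarrow> bool" where
  "lipschitz_wrt d F \<longleftrightarrow> (\<exists>C\<ge>0. \<forall>x y. \<bar>F x - F y\<bar> \<le> C * d x y)"

definition lip_seminorm :: "('v \<Rightarrow> 'v \<Rightarrow> real) \<Rightarrow> ('v \<Rightarrow> real) \<Rightarrow> real" where
  "lip_seminorm d F = Inf {C. 0 \<le> C \<and> (\<forall>x y. \<bar>F x - F y\<bar> \<le> C * d x y)}"

lemma lipschitz_wrt_dist: "lipschitz_wrt dist \<phi> \<longleftrightarrow> (\<exists>C. C-lipschitz_on UNIV \<phi>)"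
  by (auto simp: lipschitz_wrt_def lipschitz_on_def dist_real_def)

lemma lip_seminorm_dist: "lip_seminorm dist \<phi> = Inf {C. C-lipschitz_on UNIV \<phi>}"
  by (simp add: lip_seminorm_def lipschitz_on_def dist_real_def)

text \<open>A vector of \<open>\<real>\<^sup>n\<close> is represented by a sequence of which only the entries \<open>1, \<dots>, n\<close> are relevant:
  a map that is Lipschitz for \<open>l1_dist n\<close> on sequences depends on these entries only, so such maps are
  exactly the Lipschitz maps on \<open>\<real>\<^sup>n\<close>, with the same constants.\<close>

definition l1_dist :: "nat \<Rightarrow> (nat \<Rightarrow> real) \<Rightarrow> (nat \<Rightarrow> real) \<Rightarrow> real" where
  "l1_dist n x y = (\<Sum>i=1..n. \<bar>y i - x i\<bar>)"

definition sample :: "(real \<Rightarrow> 'a \<Rightarrow> real) \<Rightarrow> (nat \<Rightarrow> real) \<Rightarrow> nat \<Rightarrow> 'a \<Rightarrow> nat \<Rightarrow> real" where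
  "sample X \<Delta> n \<omega> i = X (real i * \<Delta> n) \<omega>"

text \<open>The constant of the concentration inequality. The case distinction is the convention that the
  bound is \<open>0\<close> for maps of null Lipschitz semi-norm.\<close>

definition concentration_constant ::
  "'a measure \<Rightarrow> real \<Rightarrow> (real \<Rightarrow> 'a \<Rightarrow> real) \<Rightarrow> (nat \<Rightarrow> real) \<Rightarrow> real \<Rightarrow> bool" where
  "concentration_constant M H X \<Delta> c \<longleftrightarrow> 0 < c \<and>
     (\<forall>n\<ge>1. \<forall>F r. lipschitz_wrt (l1_dist n) F \<and> 0 < r \<longrightarrow>
        \<P>(\<omega> in M. F (sample X \<Delta> n \<omega>) - (\<integral>\<omega>'. F (sample X \<Delta> n \<omega>') \<partial>M) > r)
        \<le> (if lip_seminorm (l1_dist n) F = 0 then 0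
            else exp (- (r\<^sup>2 / (c * (lip_seminorm (l1_dist n) F)\<^sup>2
                              * real n powr hurst_a H * \<Delta> n powr (- hurst_b H))))))"

definition l2_inner :: "real set \<Rightarrow> (real \<Rightarrow> real) \<Rightarrow> (real \<Rightarrow> real) \<Rightarrow> real" where
  "l2_inner I g h = (LINT x:I|lborel. g x * h x)"

definition l2_norm :: "real set \<Rightarrow> (real \<Rightarrow> real) \<Rightarrow> real" where
  "l2_norm I g = sqrt (l2_inner I g g)"

definition orthonormal_family :: "real set \<Rightarrow> nat \<Rightarrow> (nat \<Rightarrow> real \<Rightarrow> real) \<Rightarrow> bool" where
  "orthonormal_family I m \<phi> \<longleftrightarrow>
     (\<forall>j\<in>{1..m}. \<phi> j \<in> borel_measurable borel \<and> set_integrable lborel I (\<lambda>x. (\<phi> j x)\<^sup>2)) \<and>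
     (\<forall>j\<in>{1..m}. \<forall>k\<in>{1..m}. l2_inner I (\<phi> j) (\<phi> k) = (if j = k then 1 else 0))"

text \<open>In what follows \<open>\<phi> m j\<close> is the \<open>j\<close>-th function, \<open>1 \<le> j \<le> m\<close>, of the \<open>m\<close>-th family.
  The spanned spaces consist of functions, not of classes of functions: this makes no difference for
  their inclusions, since two continuous functions that agree almost everywhere are equal.\<close>

definition proj_space :: "(nat \<Rightarrow> nat \<Rightarrow> real \<Rightarrow> real) \<Rightarrow> nat \<Rightarrow> (real \<Rightarrow> real) set" where
  "proj_space \<phi> m = {g. \<exists>a. g = (\<lambda>x. \<Sum>j=1..m. a j * \<phi> m j x)}"

definition is_orthogonal_projection ::
  "real set \<Rightarrow> (real \<Rightarrow> real) set \<Rightarrow> (real \<Rightarrow> real) \<Rightarrow> (real \<Rightarrow> real) \<Rightarrow> bool" where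
  "is_orthogonal_projection I S f g \<longleftrightarrow> g \<in> S \<and> (\<forall>h\<in>S. l2_inner I (\<lambda>x. f x - g x) h = 0)"

definition lip_L :: "(nat \<Rightarrow> nat \<Rightarrow> real \<Rightarrow> real) \<Rightarrow> nat \<Rightarrow> real" where
  "lip_L \<phi> m = (\<Sum>j=1..m. (lip_seminorm dist (\<phi> m j))\<^sup>2)"

definition polynomial_growth :: "(nat \<Rightarrow> real) \<Rightarrow> bool" where
  "polynomial_growth L \<longleftrightarrow> (\<exists>C p. \<forall>m\<ge>1. L m \<le> C * real m powr p)"

text \<open>In the next two definitions \<open>x\<close> stands for the observations \<open>X\<^bsub>t\<^sub>1\<^esub>, \<dots>, X\<^bsub>t\<^sub>n\<^esub>\<close>.\<close>

definition f_hat ::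
  "(nat \<Rightarrow> nat \<Rightarrow> real \<Rightarrow> real) \<Rightarrow> nat \<Rightarrow> (nat \<Rightarrow> real) \<Rightarrow> nat \<Rightarrow> real \<Rightarrow> real" where
  "f_hat \<phi> n x m = (\<lambda>u. \<Sum>j=1..m. (1 / real n * (\<Sum>i=1..n. \<phi> m j (x i))) * \<phi> m j u)"

definition gamma_hat :: "real set \<Rightarrow> nat \<Rightarrow> (nat \<Rightarrow> real) \<Rightarrow> (real \<Rightarrow> real) \<Rightarrow> real" where
  "gamma_hat I n x g = (l2_norm I g)\<^sup>2 - 2 / real n * (\<Sum>i=1..n. g (x i))"

definition models ::
  "real \<Rightarrow> (nat \<Rightarrow> real) \<Rightarrow> (nat \<Rightarrow> nat \<Rightarrow> real \<Rightarrow> real) \<Rightarrow> nat \<Rightarrow> nat set" where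
  "models H \<Delta> \<phi> n = {m. 1 \<le> m \<and> real m * lip_L \<phi> m \<le> (real n * \<Delta> n) powr hurst_b H}"

definition pen ::
  "real \<Rightarrow> real \<Rightarrow> (nat \<Rightarrow> real) \<Rightarrow> (nat \<Rightarrow> nat \<Rightarrow> real \<Rightarrow> real) \<Rightarrow> nat \<Rightarrow> nat \<Rightarrow> real" where
  "pen K H \<Delta> \<phi> n m =
     K * ((real m + 1) * lip_L \<phi> m / (real n * \<Delta> n) powr hurst_b H)"

end

theory Submission
  imports Defs "HOL-Real_Asymp.Real_Asymp"
begin

text \<open>
  Let \<open>\<nu>(g)\<close> be the deviation of the empirical mean of \<open>g\<close> from \<open>\<langle>g, f\<rangle>\<close>. By stationarity
  \<open>\<langle>g, f\<rangle>\<close> is the mean of that empirical mean (lemma \<open>expectation_empirical_mean\<close>), and the contrast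
  of \<open>g\<close> equals \<open>\<parallel>g - f\<parallel>\<^sup>2 - \<parallel>f\<parallel>\<^sup>2 - 2 \<nu>(g)\<close>. Comparing the penalised contrasts of the selected model
  \<open>m'\<close> and of an arbitrary model \<open>m\<close> therefore gives, for every \<open>g\<close> in the \<open>m\<close>-th space,
  a bound of the loss by \<open>3 \<parallel>g - f\<parallel>\<^sup>2 + 2 pen(m) - 2 pen(m')\<close> plus \<open>8 \<Sum>\<nu>(\<phi>\<^sub>j)\<^sup>2\<close>, where the
  \<open>\<phi>\<^sub>j\<close> are the basis of the larger model \<open>p = max m m'\<close>, which by nestedness contains
  both spaces (lemma \<open>oracle_inequality\<close>).

  It remains to see that the penalties dominate the random term in the mean. The exponents of the
  concentration inequality add up to \<open>2\<close>, so that for \<open>v = c / (n \<Delta>\<^sub>n)\<^bsup>\<bb>\<^esup>\<close> it says that each \<open>\<nu>(\<phi>\<^sub>j)\<close> is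
  sub-Gaussian at scale \<open>s\<^sub>j = v \<ell>\<^sub>j\<^sup>2\<close>, where \<open>\<ell>\<^sub>j\<close> is the Lipschitz semi-norm of \<open>\<phi>\<^sub>j\<close>: its tail is at most \<open>2 exp (- r\<^sup>2 / s\<^sub>j)\<close>.
  The random index \<open>p\<close> is handled by a threshold that grows with \<open>p\<close>: the mean excess of
  \<open>\<nu>(\<phi>\<^sub>j)\<^sup>2\<close> over \<open>4 (p + 1) s\<^sub>j\<close> is at most \<open>2 s\<^sub>j exp (- 4 (p + 1))\<close>
  (lemma \<open>expectation_deviation_excess\<close>). Applying the inequality to each coordinate, and not to the
  norm of the vector of deviations, avoids any estimate of the mean of that norm.
  Eight times the sum of the thresholds over \<open>j\<close> is \<open>32 (p + 1) L(p) v\<close>, which is at most \<open>2 pen(p)\<close>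
  precisely when \<open>K \<ge> 16 c\<close>, and the mean excesses of all coordinates of all models add up to at
  most \<open>2 v \<Sum>L(p) exp (- p)\<close>, a convergent series as \<open>L\<close> has polynomial growth. This is the remainder
  of order \<open>(n \<Delta>\<^sub>n)\<^bsup>-\<bb>\<^esup>\<close>.

  That the minimum over the models exists, and that the selected index takes finitely many values,
  rests on lemma \<open>finite_models\<close>.
\<close>

section \<open>The scalar product of square integrable functions\<close>

definition square_integrable_on :: "real set \<Rightarrow> (real \<Rightarrow> real) \<Rightarrow> bool" where
  "square_integrable_on I g \<longleftrightarrow>
     g \<in> borel_measurable borel \<and> set_integrable lborel I (\<lambda>x. (g x)\<^sup>2)"

lemma set_integrable_product:
  assumes I: "I \<in> sets borel" and g: "square_integrable_on I g" and h: "square_integrable_on I h"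
  shows "set_integrable lborel I (\<lambda>x. g x * h x)"
proof (rule set_integrable_bound)
  show "set_integrable lborel I (\<lambda>x. (g x)\<^sup>2 + (h x)\<^sup>2)"
    using g h by (auto simp: square_integrable_on_def)
  show "set_borel_measurable lborel I (\<lambda>x. g x * h x)"
  proof -
    have [measurable]: "g \<in> borel_measurable borel" "h \<in> borel_measurable borel" "I \<in> sets borel"
      using g h I by (auto simp: square_integrable_on_def)
    have "(\<lambda>x. indicator I x *\<^sub>R (g x * h x)) \<in> borel_measurable borel"
      by measurable
    then show ?thesis by (simp add: set_borel_measurable_def)
  qed
  have "\<bar>g x * h x\<bar> \<le> (g x)\<^sup>2 + (h x)\<^sup>2" for x
  proof -
    have "2 * (\<bar>g x\<bar> * \<bar>h x\<bar>) \<le> (g x)\<^sup>2 + (h x)\<^sup>2"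
      using sum_squares_bound[of "\<bar>g x\<bar>" "\<bar>h x\<bar>"] by (simp add: mult.assoc)
    moreover have "0 \<le> \<bar>g x\<bar> * \<bar>h x\<bar>" by simp
    ultimately show ?thesis unfolding abs_mult by linarith
  qed
  then show "AE x in lborel. x \<in> I \<longrightarrow> norm (g x * h x) \<le> norm ((g x)\<^sup>2 + (h x)\<^sup>2)"
    by (simp add: abs_mult)
qed

lemma square_integrable_on_lincomb:
  assumes I: "I \<in> sets borel" and g: "square_integrable_on I g" and h: "square_integrable_on I h"
  shows "square_integrable_on I (\<lambda>x. a * g x + b * h x)"
proof -
  have "set_integrable lborel I (\<lambda>x. a\<^sup>2 * (g x)\<^sup>2 + (2 * a * b) * (g x * h x) + b\<^sup>2 * (h x)\<^sup>2)"
    using g h set_integrable_product[OF I g h]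
    by (intro set_integral_add(1) set_integrable_mult_right) (auto simp: square_integrable_on_def)
  moreover have "(\<lambda>x. a * g x + b * h x) \<in> borel_measurable borel"
  proof -
    have [measurable]: "g \<in> borel_measurable borel" "h \<in> borel_measurable borel"
      using g h by (auto simp: square_integrable_on_def)
    show ?thesis by measurable
  qed
  ultimately show ?thesis
    by (simp add: square_integrable_on_def power2_sum power_mult_distrib mult_ac add_ac)
qed

lemma square_integrable_on_diff:
  assumes "I \<in> sets borel" "square_integrable_on I g" "square_integrable_on I h"
  shows "square_integrable_on I (\<lambda>x. g x - h x)"
  using square_integrable_on_lincomb[OF assms, of 1 "-1"] by simp

lemma square_integrable_on_sum:
  assumes I: "I \<in> sets borel" and "finite J" "\<And>j. j \<in> J \<Longrightarrow> square_integrable_on I (g j)"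
  shows "square_integrable_on I (\<lambda>x. \<Sum>j\<in>J. a j * g j x)"
  using assms(2,3)
proof (induction J rule: finite_induct)
  case empty
  show ?case by (simp add: square_integrable_on_def set_integrable_def)
next
  case (insert k J)
  then show ?case
    using square_integrable_on_lincomb[OF I, of "g k" "\<lambda>x. \<Sum>j\<in>J. a j * g j x" "a k" 1] by simp
qed

lemma l2_inner_commute: "l2_inner I g h = l2_inner I h g"
  by (simp add: l2_inner_def mult.commute)

lemma l2_inner_lincomb_left:
  assumes I: "I \<in> sets borel"
    and "square_integrable_on I g" "square_integrable_on I h" "square_integrable_on I k"
  shows "l2_inner I (\<lambda>x. a * g x + b * h x) k = a * l2_inner I g k + b * l2_inner I h k"
proof -
  have "set_integrable lborel I (\<lambda>x. a * (g x * k x))" "set_integrable lborel I (\<lambda>x. b * (h x * k x))"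
    using assms by (auto intro!: set_integrable_mult_right set_integrable_product)
  from set_integral_add(2)[OF this] show ?thesis
    by (simp add: l2_inner_def algebra_simps)
qed

lemma l2_inner_diff_left:
  assumes "I \<in> sets borel"
    and "square_integrable_on I g" "square_integrable_on I h" "square_integrable_on I k"
  shows "l2_inner I (\<lambda>x. g x - h x) k = l2_inner I g k - l2_inner I h k"
  using l2_inner_lincomb_left[OF assms, of 1 "-1"] by simp

lemma l2_inner_sum_left:
  assumes I: "I \<in> sets borel" and "finite J" "\<And>j. j \<in> J \<Longrightarrow> square_integrable_on I (g j)"
    and k: "square_integrable_on I k"
  shows "l2_inner I (\<lambda>x. \<Sum>j\<in>J. a j * g j x) k = (\<Sum>j\<in>J. a j * l2_inner I (g j) k)"
  using assms(2,3)
proof (induction J rule: finite_induct)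
  case empty
  show ?case by (simp add: l2_inner_def set_lebesgue_integral_def)
next
  case (insert i J)
  then show ?case
    using l2_inner_lincomb_left[OF I _ square_integrable_on_sum[OF I] k, of "g i" J g "a i" 1 a]
    by simp
qed

lemma l2_norm_power2: "(l2_norm I g)\<^sup>2 = l2_inner I g g"
  unfolding l2_norm_def l2_inner_def set_lebesgue_integral_def
  by (intro real_sqrt_pow2 integral_nonneg_AE) auto

lemma l2_norm_power2_diff:
  assumes I: "I \<in> sets borel" and g: "square_integrable_on I g" and h: "square_integrable_on I h"
  shows "(l2_norm I (\<lambda>x. g x - h x))\<^sup>2 = (l2_norm I g)\<^sup>2 - 2 * l2_inner I g h + (l2_norm I h)\<^sup>2"
proof -
  note d = square_integrable_on_diff[OF I g h]
  show ?thesis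
    unfolding l2_norm_power2 l2_inner_diff_left[OF I g h d]
    using l2_inner_diff_left[OF I g h g] l2_inner_diff_left[OF I g h h]
    by (simp add: l2_inner_commute)
qed

text \<open>The parallelogram identity, with the square of the sum of \<open>g - k\<close> and \<open>h - k\<close> dropped.\<close>

lemma l2_norm_power2_diff_le:
  assumes I: "I \<in> sets borel" and g: "square_integrable_on I g" and h: "square_integrable_on I h"
    and k: "square_integrable_on I k"
  shows "(l2_norm I (\<lambda>x. g x - h x))\<^sup>2
    \<le> 2 * (l2_norm I (\<lambda>x. g x - k x))\<^sup>2 + 2 * (l2_norm I (\<lambda>x. h x - k x))\<^sup>2"
proof -
  let ?u = "\<lambda>x. g x - k x" and ?w = "\<lambda>x. h x - k x"
    and ?v = "\<lambda>x. 1 * (g x - k x) + 1 * (h x - k x)"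
  note u = square_integrable_on_diff[OF I g k] and w = square_integrable_on_diff[OF I h k]
  have v: "square_integrable_on I ?v"
    by (rule square_integrable_on_lincomb[OF I u w])
  have "0 \<le> l2_inner I ?v ?v"
    by (simp flip: l2_norm_power2)
  also have "\<dots> = l2_inner I ?v ?u + l2_inner I ?v ?w"
    unfolding l2_inner_lincomb_left[OF I u w v] by (simp add: l2_inner_commute)
  also have "\<dots> = (l2_norm I ?u)\<^sup>2 + 2 * l2_inner I ?u ?w + (l2_norm I ?w)\<^sup>2"
    unfolding l2_inner_lincomb_left[OF I u w u] l2_inner_lincomb_left[OF I u w w] l2_norm_power2
    by (simp add: l2_inner_commute)
  finally show ?thesis
    using l2_norm_power2_diff[OF I u w] by simp
qed

section \<open>Spans of orthonormal families\<close>

lemma orthonormal_familyD: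
  assumes "orthonormal_family I m \<psi>" "j \<in> {1..m}"
  shows "square_integrable_on I (\<psi> j)" "\<And>k. k \<in> {1..m} \<Longrightarrow> l2_inner I (\<psi> j) (\<psi> k) = (if j = k then 1 else 0)"
  using assms by (auto simp: orthonormal_family_def square_integrable_on_def)

lemma l2_inner_orthonormal_sums:
  assumes I: "I \<in> sets borel" and on: "orthonormal_family I m \<psi>"
  shows "l2_inner I (\<lambda>x. \<Sum>j=1..m. a j * \<psi> j x) (\<lambda>x. \<Sum>j=1..m. a' j * \<psi> j x) = (\<Sum>j=1..m. a j * a' j)"
proof -
  note si = orthonormal_familyD(1)[OF on]
  have "l2_inner I (\<psi> j) (\<lambda>x. \<Sum>k=1..m. a' k * \<psi> k x) = a' j" if j: "j \<in> {1..m}" for j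
  proof -
    have "l2_inner I (\<psi> j) (\<lambda>x. \<Sum>k=1..m. a' k * \<psi> k x) = (\<Sum>k=1..m. a' k * l2_inner I (\<psi> k) (\<psi> j))"
      by (subst l2_inner_commute, rule l2_inner_sum_left[OF I _ _ si[OF j]]) (auto intro: si)
    also have "\<dots> = (\<Sum>k=1..m. if k = j then a' k else 0)"
      using j by (intro sum.cong) (auto simp: orthonormal_familyD(2)[OF on])
    finally show ?thesis using j by simp
  qed
  then show ?thesis
    by (subst l2_inner_sum_left[OF I _ _ square_integrable_on_sum[OF I]]) (auto intro: si)
qed

lemma l2_norm_power2_orthonormal_sum:
  assumes "I \<in> sets borel" "orthonormal_family I m \<psi>"
  shows "(l2_norm I (\<lambda>x. \<Sum>j=1..m. a j * \<psi> j x))\<^sup>2 = (\<Sum>j=1..m. (a j)\<^sup>2)"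
  unfolding l2_norm_power2 l2_inner_orthonormal_sums[OF assms] by (simp add: power2_eq_square)

section \<open>The empirical contrast and the oracle inequality\<close>

definition empirical_mean :: "nat \<Rightarrow> (nat \<Rightarrow> real) \<Rightarrow> (real \<Rightarrow> real) \<Rightarrow> real" where
  "empirical_mean n x g = 1 / real n * (\<Sum>i=1..n. g (x i))"

text \<open>If the observations have the density \<open>f\<close> and \<open>g\<close> vanishes off \<open>I\<close>, the centring is at the mean.\<close>

definition deviation ::
  "real set \<Rightarrow> (real \<Rightarrow> real) \<Rightarrow> nat \<Rightarrow> (nat \<Rightarrow> real) \<Rightarrow> (real \<Rightarrow> real) \<Rightarrow> real" where
  "deviation I f n x g = empirical_mean n x g - l2_inner I g f"

lemma f_hat_alt:
  "f_hat \<phi> n x m = (\<lambda>u. \<Sum>j=1..m. empirical_mean n x (\<phi> m j) * \<phi> m j u)"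
  by (simp add: f_hat_def empirical_mean_def)

lemma empirical_mean_sum:
  "empirical_mean n x (\<lambda>u. \<Sum>j\<in>J. a j * g j u) = (\<Sum>j\<in>J. a j * empirical_mean n x (g j))"
proof -
  have "(\<Sum>i=1..n. \<Sum>j\<in>J. a j * g j (x i)) = (\<Sum>j\<in>J. a j * (\<Sum>i=1..n. g j (x i)))"
    by (subst sum.swap) (simp add: sum_distrib_left)
  then show ?thesis
    unfolding empirical_mean_def by (simp only: sum_distrib_left mult_ac)
qed

lemma gamma_hat_alt: "gamma_hat I n x g = (l2_norm I g)\<^sup>2 - 2 * empirical_mean n x g"
  by (simp add: gamma_hat_def empirical_mean_def)

text \<open>In the coordinates \<open>a\<close> of \<open>g\<close> the contrast is \<open>\<Sum>a\<^sub>j\<^sup>2 - 2 \<Sum>a\<^sub>j e\<^sub>j\<close>, where the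
  \<open>e\<^sub>j\<close> are the empirical means of the basis, and this quadratic form is minimal at \<open>a = e\<close>.\<close>

lemma gamma_hat_f_hat_le:
  assumes I: "I \<in> sets borel" and on: "orthonormal_family I m (\<phi> m)" and g: "g \<in> proj_space \<phi> m"
  shows "gamma_hat I n x (f_hat \<phi> n x m) \<le> gamma_hat I n x g"
proof -
  obtain a where a: "g = (\<lambda>u. \<Sum>j=1..m. a j * \<phi> m j u)"
    using g by (auto simp: proj_space_def)
  let ?e = "\<lambda>j. empirical_mean n x (\<phi> m j)"
  have "0 \<le> (\<Sum>j=1..m. (a j - ?e j)\<^sup>2)" by (rule sum_nonneg) simp
  also have "\<dots> = (\<Sum>j=1..m. (a j)\<^sup>2) - 2 * (\<Sum>j=1..m. a j * ?e j) + (\<Sum>j=1..m. (?e j)\<^sup>2)"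
    by (simp add: power2_diff sum.distrib sum_subtractf sum_distrib_left mult_ac)
  finally show ?thesis
    unfolding gamma_hat_alt a f_hat_alt l2_norm_power2_orthonormal_sum[OF I on] empirical_mean_sum
    by (simp add: power2_eq_square)
qed

text \<open>The contrast estimates \<open>\<parallel>g - f\<parallel>\<^sup>2\<close>, up to the constant \<open>\<parallel>f\<parallel>\<^sup>2\<close>, with an error that is linear
  in \<open>g\<close>: this turns comparisons of contrasts into comparisons of losses.\<close>

lemma gamma_hat_excess:
  assumes "I \<in> sets borel" "square_integrable_on I g" "square_integrable_on I f"
  shows "gamma_hat I n x g = (l2_norm I (\<lambda>u. g u - f u))\<^sup>2 - (l2_norm I f)\<^sup>2 - 2 * deviation I f n x g"
  unfolding gamma_hat_alt deviation_def l2_norm_power2_diff[OF assms] by simp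

text \<open>The elementary inequality \<open>2 a d \<le> a\<^sup>2 / 4 + 4 d\<^sup>2\<close> in each coordinate. The weight of \<open>\<parallel>h\<parallel>\<^sup>2\<close> is
  small enough for that term to be absorbed by the loss in the oracle inequality.\<close>

lemma deviation_orthonormal_sum_le:
  assumes I: "I \<in> sets borel" and on: "orthonormal_family I m \<psi>" and f: "square_integrable_on I f"
    and h: "h = (\<lambda>u. \<Sum>j=1..m. a j * \<psi> j u)"
  shows "2 * deviation I f n x h \<le> (l2_norm I h)\<^sup>2 / 4 + 4 * (\<Sum>j=1..m. (deviation I f n x (\<psi> j))\<^sup>2)"
proof -
  have inner: "l2_inner I h f = (\<Sum>j=1..m. a j * l2_inner I (\<psi> j) f)"
    unfolding h by (rule l2_inner_sum_left[OF I _ _ f]) (auto intro: orthonormal_familyD(1)[OF on])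
  have "2 * deviation I f n x h = (\<Sum>j=1..m. 2 * (a j * deviation I f n x (\<psi> j)))"
    unfolding deviation_def inner unfolding h empirical_mean_sum
    by (simp add: sum_subtractf right_diff_distrib sum_distrib_left)
  also have "\<dots> \<le> (\<Sum>j=1..m. (a j)\<^sup>2 / 4 + 4 * (deviation I f n x (\<psi> j))\<^sup>2)"
  proof (rule sum_mono)
    fix j
    show "2 * (a j * deviation I f n x (\<psi> j)) \<le> (a j)\<^sup>2 / 4 + 4 * (deviation I f n x (\<psi> j))\<^sup>2"
      using zero_le_power2[of "a j / 2 - 2 * deviation I f n x (\<psi> j)"]
      by (simp add: power2_diff power_divide)
  qed
  also have "\<dots> = (l2_norm I h)\<^sup>2 / 4 + 4 * (\<Sum>j=1..m. (deviation I f n x (\<psi> j))\<^sup>2)"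
    unfolding h l2_norm_power2_orthonormal_sum[OF I on]
    by (simp add: sum.distrib sum_divide_distrib sum_distrib_left)
  finally show ?thesis .
qed

lemma proj_space_diff:
  assumes "g \<in> proj_space \<phi> m" "h \<in> proj_space \<phi> m"
  shows "(\<lambda>u. g u - h u) \<in> proj_space \<phi> m"
proof -
  obtain a b where "g = (\<lambda>u. \<Sum>j=1..m. a j * \<phi> m j u)" "h = (\<lambda>u. \<Sum>j=1..m. b j * \<phi> m j u)"
    using assms by (auto simp: proj_space_def)
  then show ?thesis
    by (auto simp: proj_space_def sum_subtractf[symmetric] left_diff_distrib[symmetric] fun_eq_iff
        intro!: exI[of _ "\<lambda>j. a j - b j"])
qed

lemma square_integrable_on_proj_space:
  assumes I: "I \<in> sets borel" and on: "orthonormal_family I m (\<phi> m)" and g: "g \<in> proj_space \<phi> m"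
  shows "square_integrable_on I g"
  using g by (auto simp: proj_space_def intro!: square_integrable_on_sum[OF I] orthonormal_familyD(1)[OF on])

lemma f_hat_in_proj_space: "f_hat \<phi> n x m \<in> proj_space \<phi> m"
  unfolding f_hat_alt proj_space_def by auto

text \<open>Minimality of the contrast bounds \<open>\<parallel>e - f\<parallel>\<^sup>2 - \<parallel>g - f\<parallel>\<^sup>2\<close>, where \<open>e\<close> is the selected estimator,
  by penalties and by twice the deviation of \<open>e - g\<close>. Both functions belong to the \<open>p\<close>-th space, so
  twice that deviation is at most \<open>\<parallel>e - g\<parallel>\<^sup>2 / 4 \<le> (\<parallel>e - f\<parallel>\<^sup>2 + \<parallel>g - f\<parallel>\<^sup>2) / 2\<close> plus four times the squared
  deviations of the \<open>p\<close>-th basis; half of the loss is absorbed on the left.\<close>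

lemma oracle_inequality:
  assumes I: "I \<in> sets borel" and f: "square_integrable_on I f"
    and on: "\<And>k. k \<in> {m, m', p} \<Longrightarrow> orthonormal_family I k (\<phi> k)"
    and sub: "proj_space \<phi> m \<subseteq> proj_space \<phi> p" "proj_space \<phi> m' \<subseteq> proj_space \<phi> p"
    and g: "g \<in> proj_space \<phi> m"
    and min: "gamma_hat I n x (f_hat \<phi> n x m') + q' \<le> gamma_hat I n x (f_hat \<phi> n x m) + q"
  shows "(l2_norm I (\<lambda>u. f_hat \<phi> n x m' u - f u))\<^sup>2
    \<le> 3 * (l2_norm I (\<lambda>u. g u - f u))\<^sup>2 + 2 * (q - q')
       + 8 * (\<Sum>j=1..p. (deviation I f n x (\<phi> p j))\<^sup>2)"
proof -
  let ?e = "f_hat \<phi> n x m'"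
  have e: "?e \<in> proj_space \<phi> m'" by (rule f_hat_in_proj_space)
  have si: "square_integrable_on I ?e" "square_integrable_on I g"
    using square_integrable_on_proj_space[OF I] on e g by blast+
  have "(\<lambda>u. ?e u - g u) \<in> proj_space \<phi> p"
    using e g sub by (intro proj_space_diff) auto
  then obtain a where a: "(\<lambda>u. ?e u - g u) = (\<lambda>u. \<Sum>j=1..p. a j * \<phi> p j u)"
    by (auto simp: proj_space_def)
  have dev: "deviation I f n x (\<lambda>u. ?e u - g u) = deviation I f n x ?e - deviation I f n x g"
    unfolding deviation_def l2_inner_diff_left[OF I si f]
    by (simp add: empirical_mean_def sum_subtractf diff_divide_distrib)
  have "gamma_hat I n x ?e + q' \<le> gamma_hat I n x g + q"
    using min gamma_hat_f_hat_le[OF I on g, of n x] by simp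
  then have "(l2_norm I (\<lambda>u. ?e u - f u))\<^sup>2
      \<le> (l2_norm I (\<lambda>u. g u - f u))\<^sup>2 + q - q' + 2 * deviation I f n x (\<lambda>u. ?e u - g u)"
    unfolding gamma_hat_excess[OF I si(1) f] gamma_hat_excess[OF I si(2) f] dev by simp
  moreover have "2 * deviation I f n x (\<lambda>u. ?e u - g u)
      \<le> (l2_norm I (\<lambda>u. ?e u - g u))\<^sup>2 / 4 + 4 * (\<Sum>j=1..p. (deviation I f n x (\<phi> p j))\<^sup>2)"
    by (rule deviation_orthonormal_sum_le[OF I _ f a]) (simp add: on)
  moreover note l2_norm_power2_diff_le[OF I si f]
  ultimately show ?thesis by argo
qed

section \<open>Lipschitz semi-norms and finiteness of the collection of models\<close>

lemma lip_seminorm_le: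
  assumes "0 \<le> C" "\<And>x y. \<bar>F x - F y\<bar> \<le> C * d x y"
  shows "lip_seminorm d F \<le> C"
  unfolding lip_seminorm_def
  by (rule cInf_lower) (use assms in \<open>auto intro!: bdd_belowI[of _ 0]\<close>)

lemma lip_seminorm_nonneg:
  assumes "lipschitz_wrt d F"
  shows "0 \<le> lip_seminorm d F"
  unfolding lip_seminorm_def
  by (rule cInf_greatest) (use assms in \<open>auto simp: lipschitz_wrt_def\<close>)

text \<open>The infimum that defines the semi-norm is attained.\<close>

lemma lip_seminorm_bound:
  assumes F: "lipschitz_wrt d F" and d: "0 \<le> d x y"
  shows "\<bar>F x - F y\<bar> \<le> lip_seminorm d F * d x y"
proof (cases "d x y = 0")
  case True
  then show ?thesis using F unfolding lipschitz_wrt_def by (metis mult_zero_right)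
next
  case False
  with d have pos: "0 < d x y" by simp
  have "\<bar>F x - F y\<bar> / d x y \<le> lip_seminorm d F"
    unfolding lip_seminorm_def
    by (rule cInf_greatest) (use F pos in \<open>auto simp: lipschitz_wrt_def pos_divide_le_eq\<close>)
  then show ?thesis using pos by (simp add: pos_divide_le_eq)
qed

lemma lip_seminorm_uminus: "lip_seminorm d (\<lambda>x. - F x) = lip_seminorm d F"
proof -
  have "\<bar>- F x - - F y\<bar> = \<bar>F x - F y\<bar>" for x y by simp
  then show ?thesis unfolding lip_seminorm_def by simp
qed

lemma lipschitz_wrt_uminus: "lipschitz_wrt d F \<Longrightarrow> lipschitz_wrt d (\<lambda>x. - F x)"
proof -
  have "\<bar>- F x - - F y\<bar> = \<bar>F x - F y\<bar>" for x y by simp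
  then show "lipschitz_wrt d F \<Longrightarrow> lipschitz_wrt d (\<lambda>x. - F x)" unfolding lipschitz_wrt_def by simp
qed

text \<open>A function of null semi-norm is constant; it vanishes if \<open>I\<close> misses a point, and otherwise the
  integral of its square over the line is infinite or null, which the Bochner integral renders as
  \<open>0\<close> in both cases. Its norm cannot be \<open>1\<close>.\<close>

lemma lip_seminorm_pos:
  fixes g :: "real \<Rightarrow> real"
  assumes lip: "lipschitz_wrt dist g" and norm: "l2_inner I g g = 1"
    and van: "\<And>x. x \<notin> I \<Longrightarrow> g x = 0"
  shows "0 < lip_seminorm dist g"
proof (rule ccontr)
  assume "\<not> 0 < lip_seminorm dist g"
  then have 0: "lip_seminorm dist g = 0"
    using lip_seminorm_nonneg[OF lip] by simp
  have const: "g x = g 0" for x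
    using lip_seminorm_bound[OF lip, of x 0] 0 by simp
  show False
  proof (cases "I = UNIV")
    case True
    have "l2_inner I g g = (\<integral>x. g 0 * g 0 \<partial>(lborel :: real measure))"
      unfolding l2_inner_def set_lebesgue_integral_def True using const by (metis indicator_UNIV scaleR_one)
    also have "\<dots> = 0" by (simp add: measure_def)
    finally show False using norm by simp
  next
    case False
    then obtain x where "x \<notin> I" by auto
    then have "g y = 0" for y using const van by metis
    then show False using norm by (simp add: l2_inner_def set_lebesgue_integral_def)
  qed
qed

text \<open>The triangle and Cauchy--Schwarz inequalities. If the \<open>g\<^sub>j\<close> are orthonormal, the first factor is
  the squared norm of the combination, so that \<open>L(m)\<close> bounds the squared semi-norm of every unit
  vector of the \<open>m\<close>-th space.\<close>

lemma lip_seminorm_sum_power2_le: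
  assumes lip: "\<And>j. j \<in> J \<Longrightarrow> lipschitz_wrt dist (g j)"
  shows "(lip_seminorm dist (\<lambda>x::real. \<Sum>j\<in>J. a j * g j x))\<^sup>2
    \<le> (\<Sum>j\<in>J. (a j)\<^sup>2) * (\<Sum>j\<in>J. (lip_seminorm dist (g j))\<^sup>2)"
proof -
  let ?l = "\<lambda>j. lip_seminorm dist (g j)"
  let ?C = "\<Sum>j\<in>J. \<bar>a j\<bar> * ?l j"
  have C0: "0 \<le> ?C" by (intro sum_nonneg mult_nonneg_nonneg lip_seminorm_nonneg lip) auto
  have bd: "\<bar>(\<Sum>j\<in>J. a j * g j x) - (\<Sum>j\<in>J. a j * g j y)\<bar> \<le> ?C * dist x y" for x y
  proof -
    have "\<bar>\<Sum>j\<in>J. a j * (g j x - g j y)\<bar> \<le> (\<Sum>j\<in>J. \<bar>a j\<bar> * \<bar>g j x - g j y\<bar>)"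
      by (rule order_trans[OF sum_abs]) (simp add: abs_mult)
    also have "\<dots> \<le> (\<Sum>j\<in>J. \<bar>a j\<bar> * (?l j * dist x y))"
      by (intro sum_mono mult_left_mono lip_seminorm_bound lip) auto
    finally show ?thesis
      by (simp add: sum_subtractf right_diff_distrib sum_distrib_right mult.assoc)
  qed
  have "lipschitz_wrt dist (\<lambda>x::real. \<Sum>j\<in>J. a j * g j x)"
    unfolding lipschitz_wrt_def using C0 bd by blast
  then have "(lip_seminorm dist (\<lambda>x::real. \<Sum>j\<in>J. a j * g j x))\<^sup>2 \<le> ?C\<^sup>2"
    by (intro power_mono lip_seminorm_le[OF C0 bd] lip_seminorm_nonneg)
  also have "\<dots> \<le> (\<Sum>j\<in>J. \<bar>a j\<bar>\<^sup>2) * (\<Sum>j\<in>J. (?l j)\<^sup>2)"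
    by (rule Cauchy_Schwarz_ineq_sum)
  finally show ?thesis by simp
qed

text \<open>Nestedness keeps \<open>L\<close> away from zero: a unit vector \<open>g\<close> of one model \<open>m\<close> is a unit vector of
  every larger model \<open>k\<close>, so that \<open>L(k)\<close> is at least the squared semi-norm of \<open>g\<close>, which is positive.
  The constraint \<open>k L(k) \<le> (n \<Delta>\<^sub>n)\<^bsup>b\<^esup>\<close> then bounds \<open>k\<close>.\<close>

lemma finite_models:
  assumes I: "I \<in> sets borel"
    and on: "\<And>m. 1 \<le> m \<Longrightarrow> orthonormal_family I m (\<phi> m)"
    and van: "\<And>m j x. j \<in> {1..m} \<Longrightarrow> x \<notin> I \<Longrightarrow> \<phi> m j x = 0"
    and lip: "\<And>m j. j \<in> {1..m} \<Longrightarrow> lipschitz_wrt dist (\<phi> m j)"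
    and nested: "\<And>m m'. m \<in> models H \<Delta> \<phi> n \<Longrightarrow> m' \<in> models H \<Delta> \<phi> n \<Longrightarrow> m' \<le> m \<Longrightarrow>
              proj_space \<phi> m' \<subseteq> proj_space \<phi> m"
  shows "finite (models H \<Delta> \<phi> n)"
proof (cases "models H \<Delta> \<phi> n = {}")
  case False
  then obtain m where m: "m \<in> models H \<Delta> \<phi> n" by auto
  then have m1: "1 \<le> m" by (simp add: models_def)
  define g where "g = \<phi> m 1"
  have norm: "l2_inner I g g = 1"
    using orthonormal_familyD(2)[OF on[OF m1], of 1 1] m1 by (simp add: g_def)
  define l where "l = (lip_seminorm dist g)\<^sup>2"
  have "0 < lip_seminorm dist g"
    using lip_seminorm_pos[OF lip norm[unfolded g_def] van] m1 by (simp add: g_def)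
  then have l: "0 < l" by (simp add: l_def)
  have "g = (\<lambda>x. \<Sum>j=1..m. (if j = 1 then 1 else 0) * \<phi> m j x)"
    using m1 by (simp add: g_def if_distrib[of "\<lambda>c. c * _"] cong: if_cong)
  then have g: "g \<in> proj_space \<phi> m"
    unfolding proj_space_def by (intro CollectI exI)
  let ?R = "(real n * \<Delta> n) powr hurst_b H"
  have "k < m \<or> k \<le> nat \<lfloor>?R / l\<rfloor>" if k: "k \<in> models H \<Delta> \<phi> n" for k
  proof (cases "k < m")
    case False
    have k1: "1 \<le> k" using k by (simp add: models_def)
    from False g nested[OF k m] obtain a where a: "g = (\<lambda>x. \<Sum>j=1..k. a j * \<phi> k j x)"
      by (auto simp: proj_space_def)
    have "(\<Sum>j=1..k. (a j)\<^sup>2) = 1"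
      using l2_norm_power2_orthonormal_sum[OF I on[OF k1], of a, folded a] norm
      by (simp add: l2_norm_power2)
    then have "l \<le> lip_L \<phi> k"
      using lip_seminorm_sum_power2_le[of "{1..k}" "\<phi> k" a, folded a] lip
      by (simp add: l_def lip_L_def)
    then have "real k * l \<le> real k * lip_L \<phi> k" by (simp add: mult_left_mono)
    also have "\<dots> \<le> ?R" using k by (simp add: models_def)
    finally have "real k \<le> ?R / l" using l by (simp add: pos_le_divide_eq)
    then show ?thesis by (simp add: le_nat_floor)
  qed simp
  then have "models H \<Delta> \<phi> n \<subseteq> {..<m} \<union> {..nat \<lfloor>?R / l\<rfloor>}" by auto
  then show ?thesis by (rule finite_subset) simp
qed simp

lemma lip_L_nonneg: "0 \<le> lip_L \<phi> m"
  by (simp add: lip_L_def sum_nonneg)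

lemma summable_lip_L:
  assumes "polynomial_growth (lip_L \<phi>)"
  shows "summable (\<lambda>m. lip_L \<phi> m * exp (- real m))"
proof (rule summable_comparison_test_bigo)
  obtain C p where C: "\<And>m. 1 \<le> m \<Longrightarrow> lip_L \<phi> m \<le> C * real m powr p"
    using assms by (auto simp: polynomial_growth_def)
  have "(\<lambda>m. lip_L \<phi> m * exp (- real m)) \<in> O(\<lambda>m. real m powr p * exp (- real m))"
  proof (rule bigoI[of _ C])
    show "\<forall>\<^sub>F m in sequentially. norm (lip_L \<phi> m * exp (- real m)) \<le> C * norm (real m powr p * exp (- real m))"
      using eventually_ge_at_top[of 1]
      by eventually_elim (use C lip_L_nonneg in \<open>simp add: abs_mult mult.assoc[symmetric]\<close>)
  qed
  also have "(\<lambda>m. real m powr p * exp (- real m)) \<in> O(\<lambda>m. 1 / real m ^ 2)"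
    by real_asymp
  finally show "(\<lambda>m. lip_L \<phi> m * exp (- real m)) \<in> O(\<lambda>m. 1 / real m ^ 2)" .
  show "summable (\<lambda>m. norm (1 / real m ^ 2))"
    using inverse_power_summable[of 2, where 'a = real] by (simp add: divide_inverse)
qed

section \<open>Concentration of empirical means\<close>

text \<open>The mean of a nonnegative variable is the integral of its tail, here that of
  \<open>u \<mapsto> 2 exp (- (t + u) / s)\<close>.\<close>

lemma (in prob_space) expectation_square_excess_le:
  assumes Z[measurable]: "Z \<in> borel_measurable M" and s: "0 < s" and t: "0 \<le> t"
    and tail: "\<And>r. 0 < r \<Longrightarrow> \<P>(\<omega> in M. \<bar>Z \<omega>\<bar> > r) \<le> 2 * exp (- (r\<^sup>2 / s))"
  shows "integrable M (\<lambda>\<omega>. max 0 ((Z \<omega>)\<^sup>2 - t))"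
    and "expectation (\<lambda>\<omega>. max 0 ((Z \<omega>)\<^sup>2 - t)) \<le> 2 * s * exp (- (t / s))"
proof -
  interpret P: pair_sigma_finite M lborel ..
  \<comment> \<open>The indicator of the region below the graph of the excess, for Fubini's theorem.\<close>
  let ?ind = "\<lambda>\<omega> u. if 0 < u \<and> u < (Z \<omega>)\<^sup>2 - t then 1 else 0 :: ennreal"
  have layer: "ennreal (max 0 ((Z \<omega>)\<^sup>2 - t)) = (\<integral>\<^sup>+u. ?ind \<omega> u \<partial>lborel)" for \<omega>
  proof -
    have "(\<integral>\<^sup>+u. ?ind \<omega> u \<partial>lborel) = (\<integral>\<^sup>+u. indicator {0<..<(Z \<omega>)\<^sup>2 - t} u \<partial>lborel)"
      by (intro nn_integral_cong) (simp add: indicator_def)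
    also have "\<dots> = ennreal (max 0 ((Z \<omega>)\<^sup>2 - t))"
      by (cases "0 \<le> (Z \<omega>)\<^sup>2 - t") (auto simp: max_def)
    finally show ?thesis by simp
  qed
  have slice: "(\<integral>\<^sup>+\<omega>. ?ind \<omega> u \<partial>M) \<le> ennreal (2 * exp (- (t / s)) * exp (- (u / s))) * indicator {0..} u" for u
  proof (cases "0 < u")
    case True
    let ?A = "{\<omega> \<in> space M. \<bar>Z \<omega>\<bar> > sqrt (t + u)}"
    have eq: "u < (Z \<omega>)\<^sup>2 - t \<longleftrightarrow> sqrt (t + u) < \<bar>Z \<omega>\<bar>" for \<omega>
      using real_sqrt_less_iff[of "t + u" "(Z \<omega>)\<^sup>2"] by auto
    have "(\<integral>\<^sup>+\<omega>. ?ind \<omega> u \<partial>M) = (\<integral>\<^sup>+\<omega>. indicator ?A \<omega> \<partial>M)"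
      by (intro nn_integral_cong) (simp add: True eq indicator_def)
    also have "\<dots> = ennreal (prob ?A)"
      by (subst nn_integral_indicator) (auto simp: emeasure_eq_measure)
    also have "\<dots> \<le> ennreal (2 * exp (- ((sqrt (t + u))\<^sup>2 / s)))"
      using True t by (intro ennreal_leI tail) simp
    also have "2 * exp (- ((sqrt (t + u))\<^sup>2 / s)) = 2 * exp (- (t / s)) * exp (- (u / s))"
      using True t by (simp add: add_divide_distrib flip: exp_add)
    finally show ?thesis using True by simp
  qed simp
  have "(\<integral>\<^sup>+\<omega>. ennreal (max 0 ((Z \<omega>)\<^sup>2 - t)) \<partial>M) = (\<integral>\<^sup>+\<omega>. \<integral>\<^sup>+u. ?ind \<omega> u \<partial>lborel \<partial>M)"
    by (simp only: layer)
  also have "\<dots> = (\<integral>\<^sup>+u. \<integral>\<^sup>+\<omega>. ?ind \<omega> u \<partial>M \<partial>lborel)"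
    by (rule P.Fubini'[symmetric]) measurable
  also have "\<dots> \<le> (\<integral>\<^sup>+u. ennreal (2 * exp (- (t / s)) * exp (- (u / s))) * indicator {0..} u \<partial>lborel)"
    by (intro nn_integral_mono slice)
  also have "\<dots> = ennreal (0 - (- (2 * s * exp (- (t / s)) * exp (- (0 / s)))))"
  proof (rule nn_integral_FTC_atLeast)
    show "((\<lambda>u. - (2 * s * exp (- (t / s)) * exp (- (u / s)))) \<longlongrightarrow> 0) at_top"
      using s by real_asymp
  qed (use s in \<open>auto intro!: derivative_eq_intros\<close>)
  finally have bound: "(\<integral>\<^sup>+\<omega>. ennreal (max 0 ((Z \<omega>)\<^sup>2 - t)) \<partial>M) \<le> ennreal (2 * s * exp (- (t / s)))"
    by simp
  show "expectation (\<lambda>\<omega>. max 0 ((Z \<omega>)\<^sup>2 - t)) \<le> 2 * s * exp (- (t / s))"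
    using bound s by (intro integral_real_bounded) auto
  have "(\<integral>\<^sup>+\<omega>. ennreal (norm (max 0 ((Z \<omega>)\<^sup>2 - t))) \<partial>M) < \<infinity>"
    using bound by (auto simp: less_top[symmetric] top_unique)
  then show "integrable M (\<lambda>\<omega>. max 0 ((Z \<omega>)\<^sup>2 - t))"
    by (simp add: integrable_iff_bounded)
qed

text \<open>The exponents satisfy \<open>\<aa>\<^sub>H + \<bb>\<^sub>H = 2\<close>. Hence the factor \<open>n\<^bsup>\<aa>\<^esup> \<Delta>\<^bsup>-\<bb>\<^esup>\<close> of the concentration
  inequality compensates the squared semi-norm of an empirical mean, which is of order \<open>1 / n\<^sup>2\<close>,
  and leaves the rate \<open>(n \<Delta>)\<^bsup>-\<bb>\<^esup>\<close>.\<close>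

lemma hurst_scaling:
  assumes "0 < x" "0 < y"
  shows "x powr hurst_a H * y powr (- hurst_b H) = x\<^sup>2 / (x * y) powr hurst_b H"
proof -
  have "hurst_a H = 2 - hurst_b H" by (simp add: hurst_a_def hurst_b_def)
  then show ?thesis using assms
    by (simp add: powr_diff powr_minus_divide powr_mult)
qed

lemma empirical_mean_lipschitz:
  assumes lip: "lipschitz_wrt dist g" and n: "1 \<le> n"
  shows "lipschitz_wrt (l1_dist n) (\<lambda>x. empirical_mean n x g)"
    and "lip_seminorm (l1_dist n) (\<lambda>x. empirical_mean n x g) \<le> lip_seminorm dist g / real n"
proof -
  let ?l = "lip_seminorm dist g"
  have l: "0 \<le> ?l / real n" using lip_seminorm_nonneg[OF lip] by simp
  have bd: "\<bar>empirical_mean n x g - empirical_mean n y g\<bar> \<le> ?l / real n * l1_dist n x y" for x y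
  proof -
    have "\<bar>\<Sum>i=1..n. g (x i) - g (y i)\<bar> \<le> (\<Sum>i=1..n. ?l * \<bar>y i - x i\<bar>)"
      using lip_seminorm_bound[OF lip]
      by (intro order_trans[OF sum_abs] sum_mono) (simp add: dist_real_def abs_minus_commute)
    also have "\<dots> = ?l * l1_dist n x y" by (simp add: l1_dist_def sum_distrib_left)
    finally have "\<bar>\<Sum>i=1..n. g (x i) - g (y i)\<bar> / real n \<le> ?l * l1_dist n x y / real n"
      by (simp add: divide_right_mono)
    then show ?thesis
      by (simp add: empirical_mean_def sum_subtractf abs_divide flip: diff_divide_distrib)
  qed
  show "lip_seminorm (l1_dist n) (\<lambda>x. empirical_mean n x g) \<le> ?l / real n"
    by (rule lip_seminorm_le[OF l bd])
  show "lipschitz_wrt (l1_dist n) (\<lambda>x. empirical_mean n x g)"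
    unfolding lipschitz_wrt_def using l bd by blast
qed

text \<open>The bound of the concentration inequality increases with the semi-norm of the map, so the upper
  bound \<open>\<ell> / n\<close> for the semi-norm of the empirical mean suffices, where \<open>\<ell>\<close> is that of \<open>g\<close>.\<close>

lemma empirical_mean_concentration:
  assumes cc: "concentration_constant M H X \<Delta> c" and n: "1 \<le> n" and \<Delta>: "0 < \<Delta> n"
    and lip: "lipschitz_wrt dist g" and pos: "0 < lip_seminorm dist g" and r: "0 < r"
  shows "\<P>(\<omega> in M. empirical_mean n (sample X \<Delta> n \<omega>) g
            - (\<integral>\<omega>'. empirical_mean n (sample X \<Delta> n \<omega>') g \<partial>M) > r)
    \<le> exp (- (r\<^sup>2 / (c / (real n * \<Delta> n) powr hurst_b H * (lip_seminorm dist g)\<^sup>2)))"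
    (is "?P \<le> exp (- (_ / ?s))")
proof -
  define q where "q = lip_seminorm (l1_dist n) (\<lambda>x. empirical_mean n x g)"
  note em = empirical_mean_lipschitz[OF lip n]
  have q: "0 \<le> q" "q \<le> lip_seminorm dist g / real n"
    using lip_seminorm_nonneg[OF em(1)] em(2) by (simp_all add: q_def)
  have c: "0 < c" using cc by (simp add: concentration_constant_def)
  have "?P \<le> (if q = 0 then 0
      else exp (- (r\<^sup>2 / (c * q\<^sup>2 * real n powr hurst_a H * \<Delta> n powr (- hurst_b H)))))"
    using cc n r em(1) unfolding concentration_constant_def q_def by blast
  also have "\<dots> \<le> exp (- (r\<^sup>2 / ?s))"
  proof (cases "q = 0")
    case False
    with q have q0: "0 < q" by simp
    have "q\<^sup>2 * (real n)\<^sup>2 \<le> (lip_seminorm dist g)\<^sup>2"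
      using q n by (subst power_mult_distrib[symmetric], intro power_mono) (auto simp: field_simps)
    then have "c * (q\<^sup>2 * (real n)\<^sup>2) / (real n * \<Delta> n) powr hurst_b H
        \<le> c * (lip_seminorm dist g)\<^sup>2 / (real n * \<Delta> n) powr hurst_b H"
      using c by (intro divide_right_mono mult_left_mono) auto
    moreover have "c * q\<^sup>2 * real n powr hurst_a H * \<Delta> n powr (- hurst_b H)
        = c * (q\<^sup>2 * (real n)\<^sup>2) / (real n * \<Delta> n) powr hurst_b H"
      using hurst_scaling[of "real n" "\<Delta> n" H] n \<Delta> by (simp add: mult.assoc)
    ultimately have le: "c * q\<^sup>2 * real n powr hurst_a H * \<Delta> n powr (- hurst_b H) \<le> ?s"
      by simp
    have "0 < c * q\<^sup>2 * real n powr hurst_a H * \<Delta> n powr (- hurst_b H)"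
      using c q0 n \<Delta> by simp
    with le have "r\<^sup>2 / ?s \<le> r\<^sup>2 / (c * q\<^sup>2 * real n powr hurst_a H * \<Delta> n powr (- hurst_b H))"
      by (intro frac_le) auto
    with False show ?thesis by simp
  qed simp
  finally show ?thesis .
qed

lemma (in prob_space) empirical_mean_two_sided_concentration:
  assumes cc: "concentration_constant M H X \<Delta> c" and n: "1 \<le> n" and \<Delta>: "0 < \<Delta> n"
    and lip: "lipschitz_wrt dist g" and pos: "0 < lip_seminorm dist g" and r: "0 < r"
    and [measurable]: "(\<lambda>\<omega>. empirical_mean n (sample X \<Delta> n \<omega>) g) \<in> borel_measurable M"
    and \<mu>: "\<mu> = expectation (\<lambda>\<omega>. empirical_mean n (sample X \<Delta> n \<omega>) g)"
  shows "\<P>(\<omega> in M. \<bar>empirical_mean n (sample X \<Delta> n \<omega>) g - \<mu>\<bar> > r)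
    \<le> 2 * exp (- (r\<^sup>2 / (c / (real n * \<Delta> n) powr hurst_b H * (lip_seminorm dist g)\<^sup>2)))"
    (is "_ \<le> 2 * ?e")
proof -
  let ?Y = "\<lambda>\<omega>. empirical_mean n (sample X \<Delta> n \<omega>) g"
  have neg: "empirical_mean n x (\<lambda>u. - g u) = - empirical_mean n x g" for x
    by (simp add: empirical_mean_def sum_negf)
  have "{\<omega> \<in> space M. \<bar>?Y \<omega> - \<mu>\<bar> > r}
      = {\<omega> \<in> space M. ?Y \<omega> - \<mu> > r} \<union> {\<omega> \<in> space M. - ?Y \<omega> - - \<mu> > r}" by auto
  then have "\<P>(\<omega> in M. \<bar>?Y \<omega> - \<mu>\<bar> > r) \<le> \<P>(\<omega> in M. ?Y \<omega> - \<mu> > r) + \<P>(\<omega> in M. - ?Y \<omega> - - \<mu> > r)"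
    by (simp only:) (rule measure_Un_le; measurable)
  also have "\<dots> \<le> ?e + ?e"
    using empirical_mean_concentration[where g = g and X = X and M = M, OF cc n \<Delta> lip pos r]
      empirical_mean_concentration[where g = "\<lambda>u. - g u" and X = X and M = M, OF cc n \<Delta> lipschitz_wrt_uminus[OF lip] _ r] pos
    unfolding neg lip_seminorm_uminus \<mu> by (intro add_mono) simp_all
  finally show ?thesis by simp
qed

section \<open>Stationarity and the mean excess of a squared deviation\<close>

text \<open>Stationarity for the index set \<open>{0}\<close> is the equality of the one-dimensional laws.\<close>

lemma stationary_process_integral:
  fixes g :: "real \<Rightarrow> real"
  assumes st: "stationary_process M X" and X: "\<And>t. 0 \<le> t \<Longrightarrow> X t \<in> borel_measurable M"
    and [measurable]: "g \<in> borel_measurable borel" and t: "0 \<le> t"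
  shows "(\<integral>\<omega>. g (X t \<omega>) \<partial>M) = (\<integral>\<omega>. g (X 0 \<omega>) \<partial>M)"
proof -
  have eq: "(\<integral>v. g (v 0) \<partial>distr M (\<Pi>\<^sub>M s\<in>{0}. borel) (\<lambda>\<omega>. \<lambda>s\<in>{0::real}. X (s + h) \<omega>)) = (\<integral>\<omega>. g (X h \<omega>) \<partial>M)"
    if "0 \<le> h" for h
  proof (subst integral_distr)
    show "(\<lambda>\<omega>. \<lambda>s\<in>{0::real}. X (s + h) \<omega>) \<in> M \<rightarrow>\<^sub>M (\<Pi>\<^sub>M s\<in>{0}. borel)"
      using X[OF that] by (intro measurable_restrict) auto
    show "(\<lambda>v. g (v (0::real))) \<in> borel_measurable (\<Pi>\<^sub>M s\<in>{0}. borel)" by measurable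
  qed simp
  have "distr M (\<Pi>\<^sub>M s\<in>{0}. borel) (\<lambda>\<omega>. \<lambda>s\<in>{0::real}. X (s + t) \<omega>)
      = distr M (\<Pi>\<^sub>M s\<in>{0}. borel) (\<lambda>\<omega>. \<lambda>s\<in>{0::real}. X s \<omega>)"
    using st t unfolding stationary_process_def by (elim allE[of _ "{0}"] allE[of _ t]) auto
  then show ?thesis using eq[OF t] eq[of 0] by simp
qed

lemma (in prob_space) expectation_empirical_mean:
  assumes st: "stationary_process M X" and X: "\<And>t. 0 \<le> t \<Longrightarrow> X t \<in> borel_measurable M"
    and dens: "distributed M lborel (X 0) (\<lambda>x. ennreal (f x))" and f: "\<And>x. 0 \<le> f x"
    and g[measurable]: "g \<in> borel_measurable borel" and bd: "bounded (range g)"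
    and van: "\<And>x. x \<notin> I \<Longrightarrow> g x = 0"
    and n: "1 \<le> n" and \<Delta>: "0 < \<Delta> n"
  shows "expectation (\<lambda>\<omega>. empirical_mean n (sample X \<Delta> n \<omega>) g) = l2_inner I g f"
proof -
  obtain B where B: "\<And>x. \<bar>g x\<bar> \<le> B" using bd by (auto simp: bounded_iff)
  have int: "integrable M (\<lambda>\<omega>. g (X t \<omega>))" if "0 \<le> t" for t
    using B X[OF that] by (intro integrable_const_bound[of _ B]) auto
  have "expectation (\<lambda>\<omega>. g (X 0 \<omega>)) = (\<integral>x. f x * g x \<partial>lborel)"
    by (rule distributed_integral[OF dens, symmetric]) (auto simp: f)
  also have "\<dots> = l2_inner I g f"
    unfolding l2_inner_def set_lebesgue_integral_def
    by (intro Bochner_Integration.integral_cong) (auto simp: indicator_def van)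
  finally have 0: "expectation (\<lambda>\<omega>. g (X 0 \<omega>)) = l2_inner I g f" .
  have "expectation (\<lambda>\<omega>. empirical_mean n (sample X \<Delta> n \<omega>) g)
      = 1 / real n * (\<Sum>i=1..n. expectation (\<lambda>\<omega>. g (X (real i * \<Delta> n) \<omega>)))"
    unfolding empirical_mean_def sample_def using int \<Delta>
    by (subst integral_mult_right_zero, subst Bochner_Integration.integral_sum) auto
  also have "\<dots> = 1 / real n * (\<Sum>i=1..n. l2_inner I g f)"
    using stationary_process_integral[OF st X g] \<Delta> 0 by simp
  finally show ?thesis using n by simp
qed

lemma empirical_mean_measurable:
  assumes X: "\<And>t. 0 \<le> t \<Longrightarrow> X t \<in> borel_measurable M" and g: "g \<in> borel_measurable borel"
    and \<Delta>: "0 < \<Delta> n"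
  shows "(\<lambda>\<omega>. empirical_mean n (sample X \<Delta> n \<omega>) g) \<in> borel_measurable M"
proof -
  have "(\<lambda>\<omega>. g (X (real i * \<Delta> n) \<omega>)) \<in> borel_measurable M" for i
    using X[of "real i * \<Delta> n"] \<Delta> by (intro measurable_compose[OF _ g]) auto
  then show ?thesis
    unfolding empirical_mean_def sample_def
    by (intro borel_measurable_times borel_measurable_const borel_measurable_sum)
qed

text \<open>The threshold is \<open>\<kappa>\<close> times the scale \<open>s\<close> of the sub-Gaussian tail, so that the exponential factor
  of the bound depends on \<open>\<kappa>\<close> only.\<close>

lemma (in prob_space) expectation_deviation_excess:
  assumes st: "stationary_process M X" and X: "\<And>t. 0 \<le> t \<Longrightarrow> X t \<in> borel_measurable M"
    and dens: "distributed M lborel (X 0) (\<lambda>x. ennreal (f x))" and f: "\<And>x. 0 \<le> f x"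
    and cc: "concentration_constant M H X \<Delta> c" and n: "1 \<le> n" and \<Delta>: "0 < \<Delta> n"
    and g: "g \<in> borel_measurable borel" and bd: "bounded (range g)"
    and van: "\<And>x. x \<notin> I \<Longrightarrow> g x = 0" and norm: "l2_inner I g g = 1"
    and lip: "lipschitz_wrt dist g" and \<kappa>: "0 \<le> \<kappa>"
    and s: "s = c / (real n * \<Delta> n) powr hurst_b H * (lip_seminorm dist g)\<^sup>2"
  shows "integrable M (\<lambda>\<omega>. max 0 ((deviation I f n (sample X \<Delta> n \<omega>) g)\<^sup>2 - \<kappa> * s))"
    and "expectation (\<lambda>\<omega>. max 0 ((deviation I f n (sample X \<Delta> n \<omega>) g)\<^sup>2 - \<kappa> * s)) \<le> 2 * s * exp (- \<kappa>)"
proof -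
  note pos = lip_seminorm_pos[OF lip norm van]
  note meas = empirical_mean_measurable[where X = X and \<Delta> = \<Delta> and n = n, OF X g \<Delta>]
  have mean: "expectation (\<lambda>\<omega>. empirical_mean n (sample X \<Delta> n \<omega>) g) = l2_inner I g f"
    by (rule expectation_empirical_mean[where X = X and f = f and g = g and I = I and \<Delta> = \<Delta> and n = n, OF st X dens f g bd van n \<Delta>])
  have "0 < c" using cc by (simp add: concentration_constant_def)
  then have s0: "0 < s" using pos n \<Delta> by (simp add: s)
  have dev: "(\<lambda>\<omega>. deviation I f n (sample X \<Delta> n \<omega>) g) \<in> borel_measurable M"
    unfolding deviation_def using meas by simp
  have tail: "\<P>(\<omega> in M. \<bar>deviation I f n (sample X \<Delta> n \<omega>) g\<bar> > r) \<le> 2 * exp (- (r\<^sup>2 / s))"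
    if "0 < r" for r
    unfolding deviation_def s
    by (rule empirical_mean_two_sided_concentration[where X = X and g = g and \<Delta> = \<Delta> and n = n, OF cc n \<Delta> lip pos that meas mean[symmetric]])
  have "0 \<le> \<kappa> * s" using \<kappa> s0 by simp
  note excess = expectation_square_excess_le[OF dev s0 this tail]
  show "integrable M (\<lambda>\<omega>. max 0 ((deviation I f n (sample X \<Delta> n \<omega>) g)\<^sup>2 - \<kappa> * s))"
    by (rule excess(1))
  show "expectation (\<lambda>\<omega>. max 0 ((deviation I f n (sample X \<Delta> n \<omega>) g)\<^sup>2 - \<kappa> * s)) \<le> 2 * s * exp (- \<kappa>)"
    using excess(2) s0 by simp
qed

section \<open>The risk of the adaptive estimator\<close>

text \<open>The loss is a quadratic polynomial in the empirical means of the basis, which are bounded.\<close>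

lemma (in prob_space) integrable_loss:
  assumes I: "I \<in> sets borel" and f: "square_integrable_on I f"
    and X: "\<And>t. 0 \<le> t \<Longrightarrow> X t \<in> borel_measurable M" and \<Delta>: "0 < \<Delta> n"
    and on: "orthonormal_family I m (\<phi> m)"
    and bd: "\<And>j. j \<in> {1..m} \<Longrightarrow> bounded (range (\<phi> m j))"
  shows "integrable M (\<lambda>\<omega>. (l2_norm I (\<lambda>u. f_hat \<phi> n (sample X \<Delta> n \<omega>) m u - f u))\<^sup>2)"
proof -
  let ?e = "\<lambda>j \<omega>. empirical_mean n (sample X \<Delta> n \<omega>) (\<phi> m j)"
  have int: "integrable M (?e j)" "integrable M (\<lambda>\<omega>. (?e j \<omega>)\<^sup>2)" if j: "j \<in> {1..m}" for j
  proof -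
    obtain B where B: "\<And>x. \<bar>\<phi> m j x\<bar> \<le> B" using bd[OF j] by (auto simp: bounded_iff)
    have e: "\<bar>?e j \<omega>\<bar> \<le> B" for \<omega>
    proof -
      have "\<bar>\<Sum>i=1..n. \<phi> m j (sample X \<Delta> n \<omega> i)\<bar> \<le> (\<Sum>i=1..n. B)"
        by (intro order_trans[OF sum_abs] sum_mono B)
      moreover have "0 \<le> B" using B[of 0] by linarith
      ultimately show ?thesis
        by (cases "n = 0") (auto simp: empirical_mean_def abs_divide pos_divide_le_eq mult.commute)
    qed
    have [measurable]: "?e j \<in> borel_measurable M"
      using orthonormal_familyD(1)[OF on j] X \<Delta>
      by (intro empirical_mean_measurable) (auto simp: square_integrable_on_def)
    show "integrable M (?e j)"
      by (rule integrable_const_bound[of _ B]) (use e in auto)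
    have "(?e j \<omega>)\<^sup>2 \<le> B\<^sup>2" for \<omega>
      using e[of \<omega>] by (rule power2_le_iff_abs_le[THEN iffD2, rotated]) (use e[of \<omega>] in linarith)
    then show "integrable M (\<lambda>\<omega>. (?e j \<omega>)\<^sup>2)"
      by (intro integrable_const_bound[of _ "B\<^sup>2"]) auto
  qed
  have "(l2_norm I (\<lambda>u. f_hat \<phi> n (sample X \<Delta> n \<omega>) m u - f u))\<^sup>2
      = (\<Sum>j=1..m. (?e j \<omega>)\<^sup>2) - 2 * (\<Sum>j=1..m. ?e j \<omega> * l2_inner I (\<phi> m j) f) + (l2_norm I f)\<^sup>2" for \<omega>
  proof -
    have si: "square_integrable_on I (f_hat \<phi> n (sample X \<Delta> n \<omega>) m)"
      by (rule square_integrable_on_proj_space[where \<phi> = \<phi>, OF I on f_hat_in_proj_space])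
    have "l2_inner I (f_hat \<phi> n (sample X \<Delta> n \<omega>) m) f = (\<Sum>j=1..m. ?e j \<omega> * l2_inner I (\<phi> m j) f)"
      unfolding f_hat_alt
      by (rule l2_inner_sum_left[OF I _ _ f]) (auto intro: orthonormal_familyD(1)[OF on])
    then show ?thesis
      unfolding l2_norm_power2_diff[OF I si f]
      unfolding f_hat_alt l2_norm_power2_orthonormal_sum[OF I on] by simp
  qed
  then show ?thesis
    using int by (simp only:) (intro Bochner_Integration.integrable_add Bochner_Integration.integrable_diff
        Bochner_Integration.integrable_sum integrable_mult_right integrable_mult_left integrable_const; simp)
qed

text \<open>The squared deviations of the larger model \<open>p\<close> of \<open>m\<close> and \<open>m'\<close> exceed the thresholds
  \<open>4 (p + 1) v \<ell>\<^sub>j\<^sup>2\<close>, with the Lipschitz semi-norms \<open>\<ell>\<^sub>j\<close> of the basis, by at most the \<open>p\<close>-th inner sum on the right. As \<open>K \<ge> 16 c\<close>, eight times the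
  thresholds of \<open>p\<close> add up to at most \<open>2 pen(p)\<close>. Since \<open>p\<close> is one of \<open>m\<close> and \<open>m'\<close>, this is at most
  \<open>2 pen(m) + 2 pen(m')\<close>, even though the penalty need not be monotone, and the term \<open>pen(m')\<close>
  cancels. Summing over all models makes the bound independent of the selected one.\<close>

lemma penalised_oracle_inequality:
  assumes I: "I \<in> sets borel" and f: "square_integrable_on I f"
    and on: "\<And>k. 1 \<le> k \<Longrightarrow> orthonormal_family I k (\<phi> k)"
    and fin: "finite (models H \<Delta> \<phi> n)"
    and nested: "\<And>k k'. k \<in> models H \<Delta> \<phi> n \<Longrightarrow> k' \<in> models H \<Delta> \<phi> n \<Longrightarrow> k' \<le> k \<Longrightarrow>
              proj_space \<phi> k' \<subseteq> proj_space \<phi> k"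
    and K: "0 \<le> c" "16 * c \<le> K" and v: "v = c / (real n * \<Delta> n) powr hurst_b H"
    and m: "m \<in> models H \<Delta> \<phi> n" and g: "g \<in> proj_space \<phi> m"
    and min: "is_arg_min (\<lambda>k. gamma_hat I n x (f_hat \<phi> n x k) + pen K H \<Delta> \<phi> n k)
                (\<lambda>k. k \<in> models H \<Delta> \<phi> n) m'"
  shows "(l2_norm I (\<lambda>u. f_hat \<phi> n x m' u - f u))\<^sup>2
    \<le> 3 * (l2_norm I (\<lambda>u. g u - f u))\<^sup>2 + 4 * pen K H \<Delta> \<phi> n m
       + 8 * (\<Sum>k\<in>models H \<Delta> \<phi> n. \<Sum>j=1..k. max 0 ((deviation I f n x (\<phi> k j))\<^sup>2
                 - 4 * (real k + 1) * (v * (lip_seminorm dist (\<phi> k j))\<^sup>2)))"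
proof -
  let ?M = "models H \<Delta> \<phi> n" and ?R = "(real n * \<Delta> n) powr hurst_b H"
  let ?t = "\<lambda>k j. 4 * (real k + 1) * (v * (lip_seminorm dist (\<phi> k j))\<^sup>2)"
  let ?E = "\<lambda>k. \<Sum>j=1..k. max 0 ((deviation I f n x (\<phi> k j))\<^sup>2 - ?t k j)"
  have m': "m' \<in> ?M" using min by (simp add: is_arg_min_def)
  define p where "p = max m m'"
  have p: "p \<in> ?M" "m \<le> p" "m' \<le> p" using m m' by (auto simp: p_def max_def)
  have ge1: "1 \<le> k" if "k \<in> ?M" for k using that by (simp add: models_def)
  have pen0: "0 \<le> pen K H \<Delta> \<phi> n k" for k
    using K lip_L_nonneg[of \<phi> k] by (simp add: pen_def)
  have fit: "(l2_norm I (\<lambda>u. f_hat \<phi> n x m' u - f u))\<^sup>2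
    \<le> 3 * (l2_norm I (\<lambda>u. g u - f u))\<^sup>2 + 2 * (pen K H \<Delta> \<phi> n m - pen K H \<Delta> \<phi> n m')
       + 8 * (\<Sum>j=1..p. (deviation I f n x (\<phi> p j))\<^sup>2)"
  proof (rule oracle_inequality[OF I f _ _ _ g])
    show "orthonormal_family I k (\<phi> k)" if "k \<in> {m, m', p}" for k
      using that on ge1 m m' p(1) by blast
    show "proj_space \<phi> m \<subseteq> proj_space \<phi> p" "proj_space \<phi> m' \<subseteq> proj_space \<phi> p"
      using nested p m m' by blast+
    show "gamma_hat I n x (f_hat \<phi> n x m') + pen K H \<Delta> \<phi> n m'
        \<le> gamma_hat I n x (f_hat \<phi> n x m) + pen K H \<Delta> \<phi> n m"
      using min m by (simp add: is_arg_min_linorder)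
  qed
  have "(\<Sum>j=1..p. (deviation I f n x (\<phi> p j))\<^sup>2) \<le> (\<Sum>j=1..p. max 0 ((deviation I f n x (\<phi> p j))\<^sup>2 - ?t p j) + ?t p j)"
    by (intro sum_mono) simp
  also have "\<dots> = ?E p + 4 * ((real p + 1) * v * lip_L \<phi> p)"
    by (simp add: sum.distrib lip_L_def sum_distrib_left algebra_simps)
  finally have dev: "(\<Sum>j=1..p. (deviation I f n x (\<phi> p j))\<^sup>2) \<le> ?E p + 4 * ((real p + 1) * v * lip_L \<phi> p)" .
  have "16 * c * ((real p + 1) * lip_L \<phi> p / ?R) \<le> pen K H \<Delta> \<phi> n p"
    unfolding pen_def using K lip_L_nonneg[of \<phi> p] by (intro mult_right_mono) auto
  moreover have "32 * ((real p + 1) * v * lip_L \<phi> p)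
      = 2 * (16 * c * ((real p + 1) * lip_L \<phi> p / ?R))"
    by (simp add: v)
  ultimately have "32 * ((real p + 1) * v * lip_L \<phi> p) \<le> 2 * pen K H \<Delta> \<phi> n p"
    by linarith
  also have "\<dots> \<le> 2 * (pen K H \<Delta> \<phi> n m + pen K H \<Delta> \<phi> n m')"
    using pen0[of m] pen0[of m'] by (auto simp: p_def max_def)
  finally have penp: "32 * ((real p + 1) * v * lip_L \<phi> p) \<le> 2 * (pen K H \<Delta> \<phi> n m + pen K H \<Delta> \<phi> n m')" .
  have "?E p \<le> (\<Sum>k\<in>?M. ?E k)"
    by (rule member_le_sum[OF p(1) _ fin]) (auto intro!: sum_nonneg)
  then show ?thesis using fit dev penp by argo
qed

theorem theorem4p5:
  fixes M :: "'a measure"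
    and H \<sigma> c K m\<^sub>b :: real
    and B X :: "real \<Rightarrow> 'a \<Rightarrow> real"
    and b f :: "real \<Rightarrow> real"
    and \<Delta> :: "nat \<Rightarrow> real"
    and I :: "real set"
    and \<phi> :: "nat \<Rightarrow> nat \<Rightarrow> real \<Rightarrow> real"
    and f_proj :: "nat \<Rightarrow> real \<Rightarrow> real"
    and m_hat :: "nat \<Rightarrow> 'a \<Rightarrow> nat"
  assumes "prob_space M"
    and "0 < H" and "H < 1" and "\<sigma> \<noteq> 0"
    and "fractional_brownian_motion M H B"
    and "b C1_differentiable_on UNIV" and "bounded (range (deriv b))"
    and "0 < m\<^sub>b" and "\<And>x. deriv b x \<le> - m\<^sub>b"
    and "solves_equation M b \<sigma> B X" and "stationary_process M X"
    and "distributed M lborel (X 0) (\<lambda>x. ennreal (f x))" and "\<And>x. 0 \<le> f x"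
    and "integrable lborel (\<lambda>x. (f x)\<^sup>2)"
    and "\<And>n. 1 \<le> n \<Longrightarrow> 0 < \<Delta> n" and "\<Delta> \<longlonglongrightarrow> 0"
    and "filterlim (\<lambda>n. real n * \<Delta> n) at_top sequentially"
    and "concentration_constant M H X \<Delta> c"
    and "is_interval I"
    and "\<And>m. 1 \<le> m \<Longrightarrow> orthonormal_family I m (\<phi> m)"
    and "\<And>m j x. j \<in> {1..m} \<Longrightarrow> x \<notin> I \<Longrightarrow> \<phi> m j x = 0"
    and "\<And>m. 1 \<le> m \<Longrightarrow> is_orthogonal_projection I (proj_space \<phi> m) f (f_proj m)"
    and i: "\<And>m j. j \<in> {1..m} \<Longrightarrow>
              bounded (range (\<phi> m j)) \<and> (\<exists>C. C-lipschitz_on UNIV (\<phi> m j))"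
    and ii: "\<And>n m m'. 1 \<le> n \<Longrightarrow> m \<in> models H \<Delta> \<phi> n \<Longrightarrow> m' \<in> models H \<Delta> \<phi> n \<Longrightarrow> m' \<le> m \<Longrightarrow>
              proj_space \<phi> m' \<subseteq> proj_space \<phi> m"
    and iii: "polynomial_growth (lip_L \<phi>)"
    and "16 * c \<le> K"
    and "\<And>n. 1 \<le> n \<Longrightarrow> models H \<Delta> \<phi> n \<noteq> {} \<Longrightarrow> m_hat n \<in> measurable M (count_space UNIV)"
    and "\<And>n \<omega>. 1 \<le> n \<Longrightarrow> models H \<Delta> \<phi> n \<noteq> {} \<Longrightarrow> \<omega> \<in> space M \<Longrightarrow>
           is_arg_min (\<lambda>m. gamma_hat I n (sample X \<Delta> n \<omega>) (f_hat \<phi> n (sample X \<Delta> n \<omega>) m)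
                           + pen K H \<Delta> \<phi> n m)
                      (\<lambda>m. m \<in> models H \<Delta> \<phi> n) (m_hat n \<omega>)"
  shows "\<exists>c\<^sub>1 > 0. \<exists>c\<^sub>2 > 0. \<forall>n\<ge>1. models H \<Delta> \<phi> n \<noteq> {} \<longrightarrow>
           integrable M (\<lambda>\<omega>. (l2_norm I (\<lambda>u. f_hat \<phi> n (sample X \<Delta> n \<omega>) (m_hat n \<omega>) u - f u))\<^sup>2) \<and>
           (\<integral>\<omega>. (l2_norm I (\<lambda>u. f_hat \<phi> n (sample X \<Delta> n \<omega>) (m_hat n \<omega>) u - f u))\<^sup>2 \<partial>M)
           \<le> c\<^sub>1 * (MIN m\<in>models H \<Delta> \<phi> n. (l2_norm I (\<lambda>u. f_proj m u - f u))\<^sup>2 + pen K H \<Delta> \<phi> n m)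
             + c\<^sub>2 / (real n * \<Delta> n) powr hurst_b H"
proof -
  interpret prob_space M by fact
  note dens = assms(12) and f0 = assms(13) and \<Delta> = assms(15) and cc = assms(18)
    and on = assms(20) and van = assms(21)
  have X: "\<And>t. 0 \<le> t \<Longrightarrow> X t \<in> borel_measurable M"
    using assms(10) by (simp add: solves_equation_def)
  have I: "I \<in> sets borel" using assms(19) by (rule real_interval_borel_measurable)
  have "f \<in> borel_measurable lborel"
    using distributed_real_measurable[OF _ dens] f0 by simp
  then have f: "square_integrable_on I f"
    using integrable_mult_indicator[OF _ assms(14), of I] I
    by (simp add: square_integrable_on_def set_integrable_def)
  have lip: "\<And>m j. j \<in> {1..m} \<Longrightarrow> lipschitz_wrt dist (\<phi> m j)"
    using i by (simp add: lipschitz_wrt_dist)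
  have c: "0 < c" using cc by (simp add: concentration_constant_def)
  \<comment> \<open>Below, the factor \<open>exp (- 4 (k + 1))\<close> of the \<open>k\<close>-th model is bounded by \<open>exp (- k)\<close>.\<close>
  define S where "S = (\<Sum>m. lip_L \<phi> m * exp (- real m))"
  note summ = summable_lip_L[OF iii]
  have S0: "0 \<le> S" unfolding S_def by (intro suminf_nonneg summ mult_nonneg_nonneg lip_L_nonneg) simp
  have main: "integrable M (\<lambda>\<omega>. (l2_norm I (\<lambda>u. f_hat \<phi> n (sample X \<Delta> n \<omega>) (m_hat n \<omega>) u - f u))\<^sup>2)"
    "(\<integral>\<omega>. (l2_norm I (\<lambda>u. f_hat \<phi> n (sample X \<Delta> n \<omega>) (m_hat n \<omega>) u - f u))\<^sup>2 \<partial>M)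
       \<le> 4 * (MIN m\<in>models H \<Delta> \<phi> n. (l2_norm I (\<lambda>u. f_proj m u - f u))\<^sup>2 + pen K H \<Delta> \<phi> n m)
         + (16 * c * S + 1) / (real n * \<Delta> n) powr hurst_b H"
    if n: "1 \<le> n" and ne: "models H \<Delta> \<phi> n \<noteq> {}" for n
  proof -
    let ?M = "models H \<Delta> \<phi> n" and ?R = "(real n * \<Delta> n) powr hurst_b H"
    let ?loss = "\<lambda>m \<omega>. (l2_norm I (\<lambda>u. f_hat \<phi> n (sample X \<Delta> n \<omega>) m u - f u))\<^sup>2"
    let ?l = "\<lambda>k j. (lip_seminorm dist (\<phi> k j))\<^sup>2"
    define v where "v = c / ?R"
    let ?exc = "\<lambda>k j \<omega>. max 0 ((deviation I f n (sample X \<Delta> n \<omega>) (\<phi> k j))\<^sup>2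
                 - 4 * (real k + 1) * (v * ?l k j))"
    note argmin = assms(28)[OF n ne]
    have fin: "finite ?M"
      by (rule finite_models[OF I on van lip ii[OF n]])
    have ge1: "1 \<le> k" if "k \<in> ?M" for k using that by (simp add: models_def)
    have R: "0 < ?R" using n \<Delta>[OF n] by simp
    have v0: "0 < v" using R c by (simp add: v_def)
    have [measurable]: "m_hat n \<in> measurable M (count_space UNIV)" by (rule assms(27)[OF n ne])
    \<comment> \<open>The selected index takes finitely many values, so that measurability and integrability
      reduce to those of the losses at fixed indices.\<close>
    have split: "?loss (m_hat n \<omega>) \<omega>
        = (\<Sum>k\<in>?M. indicator {\<omega> \<in> space M. m_hat n \<omega> = k} \<omega> *\<^sub>R ?loss k \<omega>)" if \<omega>: "\<omega> \<in> space M" for \<omega>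
    proof -
      have "m_hat n \<omega> \<in> ?M" using argmin[OF \<omega>] by (simp add: is_arg_min_def)
      then show ?thesis
        using fin \<omega> by (simp add: indicator_def if_distrib[of "\<lambda>c. c * _"] cong: if_cong)
    qed
    have int_loss: "integrable M (\<lambda>\<omega>. ?loss (m_hat n \<omega>) \<omega>)"
    proof (subst Bochner_Integration.integrable_cong[OF refl split])
      show "integrable M (\<lambda>\<omega>. \<Sum>k\<in>?M. indicator {\<omega> \<in> space M. m_hat n \<omega> = k} \<omega> *\<^sub>R ?loss k \<omega>)"
        using i on ge1 \<Delta>[OF n]
        by (intro Bochner_Integration.integrable_sum integrable_mult_indicator integrable_loss[where X = X and f = f and I = I and \<Delta> = \<Delta> and n = n and \<phi> = \<phi>, OF I f X]) auto
    qed
    then show "integrable M (\<lambda>\<omega>. ?loss (m_hat n \<omega>) \<omega>)" .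
    have exc: "integrable M (?exc k j)" "expectation (?exc k j) \<le> 2 * v * (?l k j * exp (- real k))"
      if k: "k \<in> ?M" and j: "j \<in> {1..k}" for k j
    proof -
      note onk = on[OF ge1[OF k]]
      have prem: "\<phi> k j \<in> borel_measurable borel" "bounded (range (\<phi> k j))"
          "\<And>x. x \<notin> I \<Longrightarrow> \<phi> k j x = 0" "l2_inner I (\<phi> k j) (\<phi> k j) = 1"
        using orthonormal_familyD[OF onk j] i j van[OF j] by (auto simp: square_integrable_on_def)
      have \<kappa>: "0 \<le> 4 * (real k + 1)" by simp
      have "v * ?l k j = c / ?R * ?l k j" by (simp add: v_def)
      note e = expectation_deviation_excess[where X = X and f = f and g = "\<phi> k j" and I = I and \<Delta> = \<Delta> and n = n
            and \<kappa> = "4 * (real k + 1)", OF assms(11) X dens f0 cc n \<Delta>[OF n] prem lip[OF j] \<kappa> this]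
      show "integrable M (?exc k j)" by (rule e(1))
      have "expectation (?exc k j) \<le> 2 * (v * ?l k j) * exp (- (4 * (real k + 1)))"
        by (rule e(2))
      also have "\<dots> \<le> 2 * (v * ?l k j) * exp (- real k)"
        using v0 by (intro mult_left_mono) auto
      finally show "expectation (?exc k j) \<le> 2 * v * (?l k j * exp (- real k))"
        by (simp add: mult.assoc)
    qed
    let ?T = "\<lambda>\<omega>. \<Sum>k\<in>?M. \<Sum>j=1..k. ?exc k j \<omega>"
    have int_T: "integrable M ?T"
      by (intro Bochner_Integration.integrable_sum exc)
    have "expectation ?T = (\<Sum>k\<in>?M. \<Sum>j=1..k. expectation (?exc k j))"
      using exc(1) by (subst Bochner_Integration.integral_sum Bochner_Integration.integrable_sum; auto)+
    also have "\<dots> \<le> (\<Sum>k\<in>?M. \<Sum>j=1..k. 2 * v * (?l k j * exp (- real k)))"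
      by (intro sum_mono exc)
    also have "\<dots> = 2 * v * (\<Sum>k\<in>?M. lip_L \<phi> k * exp (- real k))"
      by (simp add: lip_L_def sum_distrib_left sum_distrib_right)
    also have "\<dots> \<le> 2 * v * S"
      unfolding S_def using v0 fin
      by (intro mult_left_mono sum_le_suminf summ) (auto intro!: mult_nonneg_nonneg lip_L_nonneg)
    finally have T: "expectation ?T \<le> 2 * v * S" .
    have "(MIN m\<in>?M. (l2_norm I (\<lambda>u. f_proj m u - f u))\<^sup>2 + pen K H \<Delta> \<phi> n m)
        \<in> (\<lambda>m. (l2_norm I (\<lambda>u. f_proj m u - f u))\<^sup>2 + pen K H \<Delta> \<phi> n m) ` ?M"
      by (rule Min_in) (use fin ne in auto)
    then obtain m where
      min: "(MIN m\<in>?M. (l2_norm I (\<lambda>u. f_proj m u - f u))\<^sup>2 + pen K H \<Delta> \<phi> n m)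
          = (l2_norm I (\<lambda>u. f_proj m u - f u))\<^sup>2 + pen K H \<Delta> \<phi> n m"
      and m: "m \<in> ?M"
      by (rule imageE)
    let ?bias = "(l2_norm I (\<lambda>u. f_proj m u - f u))\<^sup>2"
    have proj: "f_proj m \<in> proj_space \<phi> m"
      using assms(22)[OF ge1[OF m]] by (simp add: is_orthogonal_projection_def)
    have "expectation (\<lambda>\<omega>. ?loss (m_hat n \<omega>) \<omega>)
        \<le> expectation (\<lambda>\<omega>. 3 * ?bias + 4 * pen K H \<Delta> \<phi> n m + 8 * ?T \<omega>)"
    proof (rule integral_mono[OF int_loss])
      show "integrable M (\<lambda>\<omega>. 3 * ?bias + 4 * pen K H \<Delta> \<phi> n m + 8 * ?T \<omega>)"
        using int_T by simp
      show "?loss (m_hat n \<omega>) \<omega> \<le> 3 * ?bias + 4 * pen K H \<Delta> \<phi> n m + 8 * ?T \<omega>"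
        if \<omega>: "\<omega> \<in> space M" for \<omega>
        using c assms(26)
        by (intro penalised_oracle_inequality[OF I f on fin ii[OF n] _ _ v_def m proj argmin[OF \<omega>]]) auto
    qed
    also have "\<dots> = 3 * ?bias + 4 * pen K H \<Delta> \<phi> n m + 8 * expectation ?T"
      using int_T by (simp add: prob_space)
    also have "\<dots> \<le> 4 * (?bias + pen K H \<Delta> \<phi> n m) + 8 * (2 * v * S)"
      using T zero_le_power2[of "l2_norm I (\<lambda>u. f_proj m u - f u)"] by argo
    also have "8 * (2 * v * S) \<le> (16 * c * S + 1) / ?R"
      using R by (simp add: v_def field_simps)
    finally show "expectation (\<lambda>\<omega>. ?loss (m_hat n \<omega>) \<omega>)
        \<le> 4 * (MIN m\<in>?M. (l2_norm I (\<lambda>u. f_proj m u - f u))\<^sup>2 + pen K H \<Delta> \<phi> n m)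
          + (16 * c * S + 1) / ?R"
      unfolding min by simp
  qed
  \<comment> \<open>The summand \<open>1\<close> only makes positivity of the second constant immediate.\<close>
  have "0 < 16 * c * S + 1"
    using c S0 by (simp add: add_nonneg_pos)
  then show ?thesis
    using main by (intro exI[of _ 4] conjI exI[of _ "16 * c * S + 1"] allI impI) simp_all
qed

end
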